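(* Let $G$ be a finitely generated virtually abelian group. Then there exists a finite inverse-closed generating set $S$ of $G$ such that $\mathrm{Geo}_S(Z(G))$ is piecewise excluding (as a language over the alphabet $S$). Consequently, $\mathrm{UConjGeo}_S(G)$ is piecewise excluding, and hence regular.
   Context: For a finite inverse-closed generating set $S$ of $G$, $S^*$ is the free monoid on $S$, $\ell(w)$ is the length of a word $w\in S^*$, and $\pi\colon S^*\to G$ is the canonical surjective homomorphism. A word $w\in S^*$ is a geodesic if $\ell(w)\le\ell(u)$ for every $u\in S^*$ with $u\pi=w\pi$; $\mathrm{Geo}_S(G)$ is the set of all geodesics. For a subgroup $K\le G$, $\mathrm{Geo}_S(K)=\{w\in\mathrm{Geo}_S(G):w\pi\in K\}$. $Z(G)$ is the center of $G$. $\mathrm{UConj}$ is the equivalence relation on $G$ defined by: $(g,h)\in\mathrm{UConj}$ iff $g=h$, or both $g$ and $h$ have a conjugacy class with more than one element (i.e. both are noncentral). $\mathrm{UConjGeo}_S(G)=\{w\in\mathrm{Geo}_S(G):\ell(w)\le\ell(u)\text{ for all }u\in\mathrm{Geo}_S(G)\text{ with }(w\pi,u\pi)\in\mathrm{UConj}\}$. A word $u=a_1\cdots a_k\in A^*$ over a finite alphabet $A$ is a piecewise subword of $w\in A^*$ if $w\in A^*a_1A^*\cdots A^*a_kA^*$. A language $L\subseteq A^*$ is piecewise excluding if there is a finite set $W\subseteq A^*$ such that a word of $A^*$ belongs to $L$ if and only if it contains no element of $W$ as a piecewise subword. *)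

theory Defs
  imports "HOL-Algebra.Generated_Groups" "HOL-Library.Sublist"
begin

section \<open>Finitely generated virtually abelian groups\<close>

definition finitely_generated_group :: "('a, 'b) monoid_scheme \<Rightarrow> bool" where
  "finitely_generated_group G \<longleftrightarrow>
     group G \<and> (\<exists>X. finite X \<and> X \<subseteq> carrier G \<and> generate G X = carrier G)"

text \<open>Finite index is expressed by \<open>finite (rcosets H)\<close>; a cardinality would not do, since
  \<^const>\<open>card\<close> is 0 on infinite sets.\<close>

definition virtually_abelian_group :: "('a, 'b) monoid_scheme \<Rightarrow> bool" where
  "virtually_abelian_group G \<longleftrightarrow>
     group G \<and>
     (\<exists>H. subgroup H G \<and> comm_group (G\<lparr>carrier := H\<rparr>) \<and> finite (rcosets\<^bsub>G\<^esub> H))"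

definition center :: "('a, 'b) monoid_scheme \<Rightarrow> 'a set" where
  "center G = {z \<in> carrier G. \<forall>g\<in>carrier G. g \<otimes>\<^bsub>G\<^esub> z = z \<otimes>\<^bsub>G\<^esub> g}"

definition conj_class :: "('a, 'b) monoid_scheme \<Rightarrow> 'a \<Rightarrow> 'a set" where
  "conj_class G g = {x \<otimes>\<^bsub>G\<^esub> g \<otimes>\<^bsub>G\<^esub> inv\<^bsub>G\<^esub> x | x. x \<in> carrier G}"

text \<open>Conjugacy classes may be infinite, so ``more than one element'' is stated by
  exhibiting two distinct elements rather than through \<^const>\<open>card\<close>.\<close>

definition UConj :: "('a, 'b) monoid_scheme \<Rightarrow> ('a \<times> 'a) set" where
  "UConj G = {(g, h). g \<in> carrier G \<and> h \<in> carrier G \<and>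
     (g = h \<or>
      ((\<exists>x\<in>conj_class G g. \<exists>y\<in>conj_class G g. x \<noteq> y) \<and>
       (\<exists>x\<in>conj_class G h. \<exists>y\<in>conj_class G h. x \<noteq> y)))}"

section \<open>Words and geodesics\<close>

text \<open>The free monoid on \<open>S\<close> is \<open>lists S\<close>. As \<open>S\<close> is closed under inverses, generating \<open>G\<close>
  as a group (\<^const>\<open>generate\<close>) is the same as generating it as a monoid.\<close>

definition inverse_closed_generating_set :: "('a, 'b) monoid_scheme \<Rightarrow> 'a set \<Rightarrow> bool" where
  "inverse_closed_generating_set G S \<longleftrightarrow>
     S \<subseteq> carrier G \<and> (\<forall>s\<in>S. inv\<^bsub>G\<^esub> s \<in> S) \<and> generate G S = carrier G"

definition word_eval :: "('a, 'b) monoid_scheme \<Rightarrow> 'a list \<Rightarrow> 'a" where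
  "word_eval G w = foldr (\<otimes>\<^bsub>G\<^esub>) w \<one>\<^bsub>G\<^esub>"

definition Geo :: "('a, 'b) monoid_scheme \<Rightarrow> 'a set \<Rightarrow> 'a list set" where
  "Geo G S = {w \<in> lists S. \<forall>u\<in>lists S. word_eval G u = word_eval G w \<longrightarrow> length w \<le> length u}"

text \<open>Geodesics are taken in the ambient group \<open>G\<close>, not in \<open>K\<close>.\<close>

definition Geo_sub :: "('a, 'b) monoid_scheme \<Rightarrow> 'a set \<Rightarrow> 'a set \<Rightarrow> 'a list set" where
  "Geo_sub G S K = {w \<in> Geo G S. word_eval G w \<in> K}"

definition UConjGeo :: "('a, 'b) monoid_scheme \<Rightarrow> 'a set \<Rightarrow> 'a list set" where
  "UConjGeo G S = {w \<in> Geo G S.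
     \<forall>u\<in>Geo G S. (word_eval G w, word_eval G u) \<in> UConj G \<longrightarrow> length w \<le> length u}"

section \<open>Languages over a finite alphabet\<close>

text \<open>Piecewise subwords are the (scattered) subsequences given by \<^const>\<open>list_emb\<close> at equality,
  written \<open>subseq\<close>.\<close>

definition piecewise_excluding :: "'a set \<Rightarrow> 'a list set \<Rightarrow> bool" where
  "piecewise_excluding A L \<longleftrightarrow>
     L \<subseteq> lists A \<and>
     (\<exists>W. finite W \<and> W \<subseteq> lists A \<and>
          (\<forall>w\<in>lists A. w \<in> L \<longleftrightarrow> \<not> (\<exists>u\<in>W. subseq u w)))"

text \<open>Acceptance by a complete deterministic finite automaton; taking the states from
  \<open>nat\<close> is no restriction, since there are finitely many of them.\<close>

definition regular_language :: "'a set \<Rightarrow> 'a list set \<Rightarrow> bool" where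
  "regular_language A L \<longleftrightarrow>
     (\<exists>(Q :: nat set) q0 F \<delta>.
        finite Q \<and> q0 \<in> Q \<and> F \<subseteq> Q \<and> (\<forall>q\<in>Q. \<forall>a\<in>A. \<delta> q a \<in> Q) \<and>
        L = {w \<in> lists A. foldl \<delta> q0 w \<in> F})"

end

theory Submission
  imports Defs "HOL-Library.Infinite_Set"
begin

text \<open>By Higman's lemma a language over a finite alphabet is piecewise excluding as soon as it is
  closed under piecewise subwords. For \<open>Geo\<^sub>S(Z(G))\<close> this holds if geodesics of central elements use
  central letters only, since central letters can be moved freely. To arrange this, start from any
  finite inverse-closed generating set \<open>Y\<close>. Every subgroup of \<open>G\<close> is undistorted: Schreier
  rewriting turns a word of length \<open>k\<close> over \<open>Y\<close> into a word of length \<open>k\<close> over a finite subset of an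
  abelian subgroup of finite index, up to a coset representative, and Higman's lemma splits words
  over an abelian group with value in a subgroup into finitely many types of such words. Hence there
  is a finite \<open>D \<subseteq> Z(G)\<close> such that a central product of \<open>k\<close> letters of \<open>Y\<close> is a product of at most
  \<open>k + 2\<close> elements of \<open>D\<close>. Adding to \<open>Y\<close> all products of at most four elements of \<open>D\<close>, a central
  product of \<open>k \<ge> 2\<close> noncentral letters has length at most \<open>k - 1\<close>, because
  \<open>k + 2 \<le> 4 (k - 1)\<close>.\<close>

section \<open>Higman's lemma over a finite alphabet\<close>

definition bad_seq :: "'a set \<Rightarrow> (nat \<Rightarrow> 'a list) \<Rightarrow> bool" where
  "bad_seq A f \<longleftrightarrow> (\<forall>i. f i \<in> lists A) \<and> (\<forall>i j. i < j \<longrightarrow> \<not> subseq (f i) (f j))"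

text \<open>Nash-Williams' minimal bad sequence: the terms are fixed one after another, each as
  short as possible among the bad sequences that share the terms fixed before it.\<close>

lemma minimal_bad_seq:
  assumes "bad_seq A f0"
  obtains f where "bad_seq A f"
    and "\<And>g n. bad_seq A g \<Longrightarrow> (\<forall>i<n. g i = f i) \<Longrightarrow> length (f n) \<le> length (g n)"
proof -
  define R where "R n f g \<longleftrightarrow> (\<forall>i<n. g i = f i) \<and>
    (\<forall>h. bad_seq A h \<longrightarrow> (\<forall>i<n. h i = f i) \<longrightarrow> length (g n) \<le> length (h n))"
    for n :: nat and f g :: "nat \<Rightarrow> 'a list"
  have step: "\<exists>g. bad_seq A g \<and> R n f g" if "bad_seq A f" for f n
  proof -
    have "\<exists>g. (bad_seq A g \<and> (\<forall>i<n. g i = f i)) \<and>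
      (\<forall>h. bad_seq A h \<and> (\<forall>i<n. h i = f i) \<longrightarrow> length (g n) \<le> length (h n))"
      using ex_has_least_nat[of "\<lambda>g. bad_seq A g \<and> (\<forall>i<n. g i = f i)" f "\<lambda>g. length (g n)"] that
      by blast
    then show ?thesis unfolding R_def by blast
  qed
  obtain F where F: "\<And>n. bad_seq A (F n)" "\<And>n. R n (F n) (F (Suc n))"
    using dependent_nat_choice[of "\<lambda>_. bad_seq A" R] assms step by metis
  have stable: "F (n + k) i = F n i" if "i < n" for n k i
    using that by (induction k) (use F(2) in \<open>auto simp: R_def\<close>)
  \<comment> \<open>Term \<open>n\<close> is final from stage \<open>Suc n\<close> on, so any two
    terms of the diagonal sequence already occur together in one bad sequence
    \<open>F m\<close>.\<close>
  define f where "f n = F (Suc n) n" for n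
  have agree: "F n i = f i" if "i < n" for n i
    using stable[of i "Suc i" "n - Suc i"] that by (simp add: f_def)
  have "bad_seq A f"
    unfolding bad_seq_def
  proof (intro conjI allI impI)
    show "f i \<in> lists A" for i
      using F(1)[of "Suc i"] by (simp only: f_def bad_seq_def)
    show "\<not> subseq (f i) (f j)" if "i < j" for i j
      using F(1)[of "Suc j"] that agree[of i "Suc j"] agree[of j "Suc j"]
      unfolding bad_seq_def by (metis less_Suc_eq)
  qed
  moreover have "length (f n) \<le> length (g n)" if "bad_seq A g" "\<forall>i<n. g i = f i" for g n
  proof -
    have "\<forall>i<n. g i = F n i" using that(2) agree by simp
    then show ?thesis using F(2)[of n] that(1) by (auto simp: R_def f_def)
  qed
  ultimately show ?thesis using that by blast
qed

text \<open>In a minimal bad sequence, infinitely many terms begin with the same letter. Deleting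
  this letter from them, and keeping only the terms before the first of them in front, leaves a bad
  sequence that violates minimality.\<close>

lemma no_bad_seq:
  assumes "finite A"
  shows "\<not> bad_seq A f0"
proof
  assume "bad_seq A f0"
  then obtain f where bad: "bad_seq A f"
    and min: "\<And>g n. bad_seq A g \<Longrightarrow> (\<forall>i<n. g i = f i) \<Longrightarrow> length (f n) \<le> length (g n)"
    using minimal_bad_seq by blast
  have good: "\<not> subseq (f i) (f j)" if "i < j" for i j
    using bad that by (auto simp: bad_seq_def)
  have ne: "f i \<noteq> []" for i
    using good[of i "Suc i"] by auto
  have inA: "set (f i) \<subseteq> A" for i
    using bad by (auto simp: bad_seq_def)
  have "range (\<lambda>i. hd (f i)) \<subseteq> A"
    using inA ne by (auto dest: hd_in_set)
  then have "finite (range (\<lambda>i. hd (f i)))"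
    using assms finite_subset by blast
  then obtain k where "infinite {i \<in> UNIV. hd (f i) = hd (f k)}"
    using pigeonhole_infinite[of UNIV "\<lambda>i. hd (f i)"] by auto
  then have inf: "infinite {i. hd (f i) = hd (f k)}" by simp
  define e where "e = Infinite_Set.enumerate {i. hd (f i) = hd (f k)}"
  have e_mono: "e i < e j" if "i < j" for i j
    unfolding e_def using enumerate_mono[OF that inf] .
  have e_hd: "hd (f (e i)) = hd (f k)" for i
    using enumerate_in_set[OF inf, of i] by (simp add: e_def)
  have e_min: "e 0 \<le> e i" for i
    using e_mono[of 0 i] by (cases i) auto
  have cons: "f (e i) = hd (f k) # tl (f (e i))" for i
    using ne[of "e i"] e_hd[of i] by (metis list.collapse)
  \<comment> \<open>Position \<open>e 0\<close> is where minimality fails: \<open>g\<close> agrees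
    with \<open>f\<close> before it and is one letter shorter there.\<close>
  define g where "g i = (if i < e 0 then f i else tl (f (e (i - e 0))))" for i
  have "bad_seq A g"
    unfolding bad_seq_def
  proof (intro conjI allI impI)
    show "g i \<in> lists A" for i
      using inA by (auto simp: g_def dest: list.set_sel(2)[OF ne])
    fix i j :: nat assume "i < j"
    consider "j < e 0" | "i < e 0" "e 0 \<le> j" | "e 0 \<le> i" by linarith
    then show "\<not> subseq (g i) (g j)"
    proof cases
      case 1
      then show ?thesis using \<open>i < j\<close> good by (simp add: g_def)
    next
      case 2
      have "\<not> subseq (f i) (f (e (j - e 0)))"
        using good e_min[of "j - e 0"] 2(1) by simp
      then have "\<not> subseq (f i) (tl (f (e (j - e 0))))"
        by (subst (asm) cons) auto
      then show ?thesis using 2 by (simp add: g_def)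
    next
      case 3
      then have "\<not> subseq (f (e (i - e 0))) (f (e (j - e 0)))"
        using good e_mono \<open>i < j\<close> by simp
      then have "\<not> subseq (tl (f (e (i - e 0)))) (tl (f (e (j - e 0))))"
        by (subst (asm) (1 2) cons) auto
      then show ?thesis using 3 \<open>i < j\<close> by (simp add: g_def)
    qed
  qed
  then have "length (f (e 0)) \<le> length (g (e 0))"
    by (rule min) (simp add: g_def)
  then show False
    using cons[of 0] by (metis g_def diff_self_eq_0 less_irrefl length_Cons not_less_eq_eq order_refl)
qed

text \<open>The minimal words of \<open>L\<close> form an antichain, and an infinite antichain would
  enumerate to a bad sequence. Descent on length finds a minimal word below every word of
  \<open>L\<close>.\<close>

theorem higman_finite_basis:
  assumes "finite A" "L \<subseteq> lists A"
  obtains M where "finite M" "M \<subseteq> L" "\<And>w. w \<in> L \<Longrightarrow> \<exists>u\<in>M. subseq u w"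
proof
  define M where "M = {w \<in> L. \<forall>u\<in>L. subseq u w \<longrightarrow> u = w}"
  show "M \<subseteq> L" by (auto simp: M_def)
  show "finite M"
  proof (rule ccontr)
    assume "infinite M"
    then obtain f :: "nat \<Rightarrow> 'a list" where f: "inj f" "range f \<subseteq> M"
      using infinite_countable_subset by blast
    have "bad_seq A f"
      unfolding bad_seq_def
    proof (intro conjI allI impI)
      show "f i \<in> lists A" for i
        using f(2) assms(2) by (auto simp: M_def)
      fix i j :: nat assume "i < j"
      show "\<not> subseq (f i) (f j)"
      proof
        assume "subseq (f i) (f j)"
        moreover have "f i \<in> L" "f j \<in> M" using f(2) by (auto simp: M_def)
        ultimately have "f i = f j" by (auto simp: M_def)
        then show False using f(1) \<open>i < j\<close> by (auto dest: injD)
      qed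
    qed
    then show False using no_bad_seq[OF assms(1)] by blast
  qed
  show "\<exists>u\<in>M. subseq u w" if "w \<in> L" for w
    using that
  proof (induction w rule: measure_induct_rule[of length])
    case (less w)
    show ?case
    proof (cases "w \<in> M")
      case False
      then obtain u where u: "u \<in> L" "subseq u w" "u \<noteq> w"
        using less.prems by (auto simp: M_def)
      then have "length u < length w"
        using list_emb_length[OF u(2)] subseq_same_length[OF u(2)] by (auto simp: order_less_le)
      then show ?thesis
        using less.IH[OF _ u(1)] u(2) subseq_order.order_trans by metis
    qed auto
  qed
qed

lemma set_subseq_subset: "subseq u w \<Longrightarrow> set u \<subseteq> set w"
  by (induction rule: list_emb.induct) auto

text \<open>The forbidden words are a finite basis of the complement of \<open>L\<close>. Closure
  under piecewise subwords keeps words of \<open>L\<close> from containing any of them.\<close>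

lemma subseq_closed_imp_piecewise_excluding:
  assumes "finite A" "L \<subseteq> lists A" "\<And>u w. w \<in> L \<Longrightarrow> subseq u w \<Longrightarrow> u \<in> L"
  shows "piecewise_excluding A L"
proof -
  obtain W where W: "finite W" "W \<subseteq> lists A - L" "\<And>w. w \<in> lists A - L \<Longrightarrow> \<exists>u\<in>W. subseq u w"
    using higman_finite_basis[OF assms(1), of "lists A - L"] by blast
  show ?thesis
    unfolding piecewise_excluding_def
    by (intro conjI assms(2) exI[of _ W]) (use W assms(3) in blast)+
qed

section \<open>Regularity of piecewise excluding languages\<close>

text \<open>Lets automata have states of any type: a finite state set is transported to
  \<open>nat\<close> along an injection.\<close>

lemma regular_language_of_finite_automaton:
  assumes "finite Q" "q0 \<in> Q" "\<And>q a. q \<in> Q \<Longrightarrow> a \<in> A \<Longrightarrow> \<delta> q a \<in> Q"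
  shows "regular_language A {w \<in> lists A. P (foldl \<delta> q0 w)}"
proof -
  obtain f :: "_ \<Rightarrow> nat" where f: "inj_on f Q"
    using finite_imp_inj_to_nat_seg[OF assms(1)] by blast
  define \<delta>' where "\<delta>' n a = f (\<delta> (inv_into Q f n) a)" for n a
  have run: "foldl \<delta>' (f q) w = f (foldl \<delta> q w) \<and> foldl \<delta> q w \<in> Q"
    if "w \<in> lists A" "q \<in> Q" for w q
    using that by (induction w arbitrary: q) (simp_all add: \<delta>'_def f assms(3))
  define F where "F = f ` {q \<in> Q. P q}"
  have "{w \<in> lists A. P (foldl \<delta> q0 w)} = {w \<in> lists A. foldl \<delta>' (f q0) w \<in> F}"
  proof (intro Collect_cong conj_cong refl)
    fix w assume "w \<in> lists A"
    from run[OF this assms(2)] f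
    show "P (foldl \<delta> q0 w) \<longleftrightarrow> foldl \<delta>' (f q0) w \<in> F"
      by (auto simp: F_def dest: inj_onD)
  qed
  moreover have "\<forall>q\<in>f ` Q. \<forall>a\<in>A. \<delta>' q a \<in> f ` Q"
    using f assms(3) by (auto simp: \<delta>'_def)
  moreover have "F \<subseteq> f ` Q" by (auto simp: F_def)
  ultimately show ?thesis
    unfolding regular_language_def using assms(1,2) by blast
qed

text \<open>The unmatched remainder of a pattern under greedy leftmost matching, which succeeds
  whenever the pattern occurs as a piecewise subword.\<close>

fun match_step :: "'a list \<Rightarrow> 'a \<Rightarrow> 'a list" where
  "match_step [] a = []"
| "match_step (x # xs) a = (if x = a then xs else x # xs)"

lemma foldl_match_step_Nil [simp]: "foldl match_step [] w = []"
  by (induction w) auto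

lemma subseq_iff_match: "subseq u w \<longleftrightarrow> foldl match_step u w = []"
proof (induction w arbitrary: u)
  case Nil
  then show ?case by (cases u) simp_all
next
  case (Cons a w)
  then show ?case by (cases u) (simp_all add: subseq_Cons2_iff)
qed

lemma suffix_match_step: "suffix (match_step v a) v"
  by (cases v) (auto simp: suffix_def)

text \<open>A product automaton matches all forbidden words at once. Its states are lists of
  remainders, one per forbidden word; these are suffixes, so there are finitely many states. A word
  is rejected once some remainder is empty.\<close>

lemma piecewise_excluding_imp_regular:
  assumes "piecewise_excluding A L"
  shows "regular_language A L"
proof -
  obtain W where W: "finite W" "L \<subseteq> lists A" "\<forall>w\<in>lists A. w \<in> L \<longleftrightarrow> \<not> (\<exists>u\<in>W. subseq u w)"
    using assms unfolding piecewise_excluding_def by metis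
  obtain us where us: "set us = W"
    using finite_list[OF W(1)] by blast
  define V where "V = (\<Union>u\<in>W. {v. suffix v u})"
  define Q where "Q = {vs. set vs \<subseteq> V \<and> length vs = length us}"
  define \<delta> where "\<delta> q a = map (\<lambda>v. match_step v a) q" for q and a :: 'a
  have "finite {v. suffix v u}" for u :: "'a list"
    using List.finite_set[of "suffixes u"] by (simp add: set_suffixes_eq)
  then have "finite Q"
    unfolding Q_def V_def using W(1) by (intro finite_lists_length_eq) simp
  moreover have "us \<in> Q" by (auto simp: Q_def V_def us)
  moreover have "\<delta> q a \<in> Q" if "q \<in> Q" for q a
    using that suffix_match_step suffix_order.order_trans by (fastforce simp: Q_def V_def \<delta>_def)
  ultimately have "regular_language A {w \<in> lists A. [] \<notin> set (foldl \<delta> us w)}"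
    by (rule regular_language_of_finite_automaton)
  moreover have "foldl \<delta> vs w = map (\<lambda>v. foldl match_step v w) vs" for vs w
    by (induction w arbitrary: vs) (simp_all add: \<delta>_def)
  then have "w \<in> L \<longleftrightarrow> [] \<notin> set (foldl \<delta> us w)" if "w \<in> lists A" for w
    using W(3)[rule_format, OF that] by (auto simp: us subseq_iff_match image_iff)
  then have "{w \<in> lists A. [] \<notin> set (foldl \<delta> us w)} = L"
    using W(2) by blast
  ultimately show ?thesis by simp
qed

section \<open>Words in groups\<close>

lemma word_eval_Nil [simp]: "word_eval G [] = \<one>\<^bsub>G\<^esub>"
  by (simp add: word_eval_def)

lemma word_eval_Cons [simp]: "word_eval G (x # w) = x \<otimes>\<^bsub>G\<^esub> word_eval G w"
  by (simp add: word_eval_def)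

context group
begin

lemma word_eval_subgroup: "subgroup H G \<Longrightarrow> set w \<subseteq> H \<Longrightarrow> word_eval G w \<in> H"
  by (induction w) (auto simp: subgroup.one_closed subgroup.m_closed)

lemma word_eval_closed [simp]: "set w \<subseteq> carrier G \<Longrightarrow> word_eval G w \<in> carrier G"
  using word_eval_subgroup[OF subgroup_self] .

lemma word_eval_append:
  "set v \<subseteq> carrier G \<Longrightarrow> set w \<subseteq> carrier G \<Longrightarrow>
    word_eval G (v @ w) = word_eval G v \<otimes> word_eval G w"
  by (induction v) (auto simp: m_assoc)

text \<open>Inside a commutative subgroup, the letters of \<open>w\<close> outside an occurrence of
  \<open>u\<close> can be moved to the right, where they form \<open>r\<close>.\<close>

lemma word_eval_commuting_subseq:
  assumes "subseq u w" "set w \<subseteq> H" "subgroup H G"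
    and comm: "\<And>x y. x \<in> H \<Longrightarrow> y \<in> H \<Longrightarrow> x \<otimes> y = y \<otimes> x"
  shows "\<exists>r. set r \<subseteq> set w \<and> length w = length u + length r \<and>
    word_eval G w = word_eval G u \<otimes> word_eval G r"
  using assms(1,2)
proof (induction rule: list_emb.induct)
  case (list_emb_Nil w)
  then show ?case
    using assms(3) by (intro exI[of _ w]) (auto dest: subgroup.subset)
next
  case (list_emb_Cons u w y)
  then obtain r where r: "set r \<subseteq> set w" "length w = length u + length r"
    "word_eval G w = word_eval G u \<otimes> word_eval G r" by auto
  have mem: "y \<in> H" "word_eval G u \<in> H" "word_eval G r \<in> H"
    using list_emb_Cons.prems r(1) set_subseq_subset[OF list_emb_Cons(1)] assms(3)
    by (auto intro!: word_eval_subgroup)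
  then have car: "y \<in> carrier G" "word_eval G u \<in> carrier G" "word_eval G r \<in> carrier G"
    using subgroup.mem_carrier[OF assms(3)] by auto
  have "word_eval G (y # w) = word_eval G u \<otimes> word_eval G (y # r)"
    using car comm[OF mem(1,2)] by (simp add: r(3) m_assoc[symmetric])
  then show ?case using r by (intro exI[of _ "y # r"]) auto
next
  case (list_emb_Cons2 x y u w)
  then obtain r where r: "set r \<subseteq> set w" "length w = length u + length r"
    "word_eval G w = word_eval G u \<otimes> word_eval G r" by auto
  have "x \<in> carrier G" "word_eval G u \<in> carrier G" "word_eval G r \<in> carrier G"
    using list_emb_Cons2.prems r(1) set_subseq_subset[OF list_emb_Cons2(2)]
      list_emb_Cons2(1) subgroup.subset[OF assms(3)]
    by (auto intro!: word_eval_closed)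
  then show ?case
    using r list_emb_Cons2(1) by (intro exI[of _ r]) (auto simp: m_assoc)
qed

section \<open>Subgroups of virtually abelian groups are undistorted\<close>

text \<open>Higman's lemma gives finitely many basis words such that every nonempty word over
  \<open>B\<close> with value in \<open>P\<close> contains one of them. By commutativity it can be
  split off, and the rest again has value in \<open>P\<close>. Each split uses up at least one
  letter and yields one letter of the new word.\<close>

lemma abelian_subgroup_undistorted:
  assumes "subgroup H G" and comm: "\<And>x y. x \<in> H \<Longrightarrow> y \<in> H \<Longrightarrow> x \<otimes> y = y \<otimes> x"
    and "subgroup P G" "finite B" "B \<subseteq> H"
  obtains X where "finite X" "X \<subseteq> P"
    "\<And>w. w \<in> lists B \<Longrightarrow> word_eval G w \<in> P \<Longrightarrow>
      \<exists>v\<in>lists X. length v \<le> length w \<and> word_eval G v = word_eval G w"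
proof -
  \<comment> \<open>The empty word is left out, since it would be the only minimal word and
    splitting it off would not shorten anything.\<close>
  define L where "L = {w \<in> lists B. w \<noteq> [] \<and> word_eval G w \<in> P}"
  obtain M where M: "finite M" "M \<subseteq> L" "\<And>w. w \<in> L \<Longrightarrow> \<exists>u\<in>M. subseq u w"
    using higman_finite_basis[of B L] assms(4) by (auto simp: L_def)
  have car: "set w \<subseteq> carrier G" if "w \<in> lists B" for w
    using that assms(5) subgroup.subset[OF assms(1)] by auto
  have "\<exists>v\<in>lists (word_eval G ` M). length v \<le> length w \<and> word_eval G v = word_eval G w"
    if "w \<in> lists B" "word_eval G w \<in> P" for w
    using that
  proof (induction w rule: measure_induct_rule[of length])
    case (less w)
    show ?case
    proof (cases "w = []")
      case True
      then show ?thesis by (intro bexI[of _ "[]"]) auto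
    next
      case False
      then obtain u where u: "u \<in> M" "subseq u w"
        using M(3) less.prems by (auto simp: L_def)
      have uL: "u \<in> lists B" "u \<noteq> []" "word_eval G u \<in> P"
        using u(1) M(2) by (auto simp: L_def)
      obtain r where r: "set r \<subseteq> set w" "length w = length u + length r"
        "word_eval G w = word_eval G u \<otimes> word_eval G r"
        using word_eval_commuting_subseq[OF u(2) _ assms(1) comm] less.prems(1) assms(5) by blast
      have rB: "r \<in> lists B" using r(1) less.prems(1) by auto
      have "word_eval G r = inv (word_eval G u) \<otimes> word_eval G w"
        using car[OF uL(1)] car[OF rB] by (simp add: r(3) m_assoc[symmetric])
      then have "word_eval G r \<in> P"
        using uL(3) less.prems(2) assms(3)
        by (simp add: subgroup.m_closed subgroup.m_inv_closed)
      moreover have "length r < length w" using r(2) uL(2) by simp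
      ultimately obtain v where v: "v \<in> lists (word_eval G ` M)" "length v \<le> length r"
        "word_eval G v = word_eval G r"
        using less.IH rB by blast
      have "Suc (length v) \<le> length w"
        using v(2) r(2) uL(2) by (cases u) auto
      then show ?thesis
        using u(1) v r(3) by (intro bexI[of _ "word_eval G u # v"]) auto
    qed
  qed
  moreover have "word_eval G ` M \<subseteq> P" using M(2) by (auto simp: L_def)
  ultimately show ?thesis using that M(1) by blast
qed

section \<open>Coset representatives and Schreier rewriting\<close>

lemma finite_transversal:
  assumes "subgroup H G" "finite (rcosets H)"
  obtains T where "finite T" "T \<subseteq> carrier G" "\<one> \<in> T"
    "\<And>g. g \<in> carrier G \<Longrightarrow> \<exists>h\<in>H. \<exists>t\<in>T. g = h \<otimes> t"
proof -
  have "\<forall>C\<in>rcosets H. \<exists>t\<in>carrier G. C = H #> t"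
    by (auto simp: RCOSETS_def)
  then obtain c where c: "\<And>C. C \<in> rcosets H \<Longrightarrow> c C \<in> carrier G \<and> C = H #> c C"
    by metis
  \<comment> \<open>Inserting \<open>\<one>\<close> lets the rewriting of a word start at the
    identity. The coset \<open>H\<close> may thereby get two representatives.\<close>
  have "\<exists>h\<in>H. \<exists>t\<in>insert \<one> (c ` (rcosets H)). g = h \<otimes> t" if "g \<in> carrier G" for g
  proof -
    have C: "H #> g \<in> rcosets H" using that by (auto simp: RCOSETS_def)
    then have "g \<in> H #> c (H #> g)"
      using rcos_self[OF that assms(1)] c by blast
    then show ?thesis using C by (auto simp: r_coset_def)
  qed
  then show ?thesis
    using that[of "insert \<one> (c ` (rcosets H))"] assms(2) c by blast
qed

text \<open>The word is read letter by letter while a representative \<open>t\<close> of the current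
  coset is kept. Each letter \<open>y\<close> satisfies \<open>t \<otimes> y = h \<otimes> s\<close>
  with \<open>h\<close> in \<open>H\<close>, so it emits one Schreier generator
  \<open>h = t \<otimes> y \<otimes> inv s\<close>.\<close>

lemma schreier_rewriting:
  assumes "subgroup H G" "T \<subseteq> carrier G" "Y \<subseteq> carrier G" "finite T" "finite Y"
    and T: "\<And>g. g \<in> carrier G \<Longrightarrow> \<exists>h\<in>H. \<exists>t\<in>T. g = h \<otimes> t"
  obtains B where "finite B" "B \<subseteq> H"
    "\<And>w t. w \<in> lists Y \<Longrightarrow> t \<in> T \<Longrightarrow>
      \<exists>v\<in>lists B. \<exists>t'\<in>T. length v = length w \<and> t \<otimes> word_eval G w = word_eval G v \<otimes> t'"
proof -
  define B where "B = H \<inter> (\<lambda>(t, y, t'). t \<otimes> y \<otimes> inv t') ` (T \<times> Y \<times> T)"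
  have "finite B" unfolding B_def using assms(4,5) by simp
  moreover have "B \<subseteq> H" by (simp add: B_def)
  moreover have "\<exists>v\<in>lists B. \<exists>t'\<in>T. length v = length w \<and> t \<otimes> word_eval G w = word_eval G v \<otimes> t'"
    if "w \<in> lists Y" "t \<in> T" for w t
    using that
  proof (induction w arbitrary: t rule: list.induct)
    case Nil
    then show ?case using assms(2) by (intro bexI[of _ "[]"] bexI[of _ t]) auto
  next
    case (Cons y w)
    have mem: "t \<in> carrier G" "y \<in> carrier G" "set w \<subseteq> carrier G"
      using Cons.prems assms(2,3) by auto
    obtain h s where hs: "h \<in> H" "s \<in> T" "t \<otimes> y = h \<otimes> s"
      using T[of "t \<otimes> y"] mem by auto
    have car: "h \<in> carrier G" "s \<in> carrier G"
      using hs assms(2) subgroup.mem_carrier[OF assms(1)] by auto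
    have "h = t \<otimes> y \<otimes> inv s" using car by (simp add: hs(3) m_assoc)
    then have hB: "h \<in> B"
      unfolding B_def using hs Cons.prems by (auto intro!: image_eqI[of _ _ "(t, y, s)"])
    obtain v t' where v: "v \<in> lists B" "t' \<in> T" "length v = length w"
      "s \<otimes> word_eval G w = word_eval G v \<otimes> t'"
      using Cons.IH[of s] Cons.prems hs(2) by auto
    have vcar: "set v \<subseteq> carrier G" "t' \<in> carrier G"
      using v(1,2) \<open>B \<subseteq> H\<close> subgroup.subset[OF assms(1)] assms(2) by auto
    have "t \<otimes> word_eval G (y # w) = (t \<otimes> y) \<otimes> word_eval G w"
      using mem by (simp add: m_assoc)
    also have "\<dots> = h \<otimes> (s \<otimes> word_eval G w)"
      using mem car by (simp add: hs(3) m_assoc)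
    also have "\<dots> = word_eval G (h # v) \<otimes> t'"
      using car vcar by (simp add: v(4) m_assoc)
    finally show ?case
      using hB v by (intro bexI[of _ "h # v"] bexI[of _ t']) auto
  qed
  ultimately show ?thesis using that by blast
qed

text \<open>Rewriting gives a word over \<open>B\<close> times a representative \<open>t\<close>. A
  fixed \<open>b t\<close> in \<open>H\<close> with \<open>b t \<otimes> t\<close> in
  \<open>P\<close> corrects this: the word followed by \<open>inv (b t)\<close> has value in both
  \<open>H\<close> and \<open>P\<close>, where the abelian case applies, and
  \<open>b t \<otimes> t\<close> is a letter of \<open>D\<close>. These two corrections account for
  the summand 2.\<close>

theorem subgroup_undistorted:
  assumes "subgroup H G" and comm: "\<And>x y. x \<in> H \<Longrightarrow> y \<in> H \<Longrightarrow> x \<otimes> y = y \<otimes> x"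
    and "finite (rcosets H)" "subgroup P G" "finite Y" "Y \<subseteq> carrier G"
  obtains D where "finite D" "D \<subseteq> P"
    "\<And>w. w \<in> lists Y \<Longrightarrow> word_eval G w \<in> P \<Longrightarrow>
      \<exists>v\<in>lists D. length v \<le> length w + 2 \<and> word_eval G v = word_eval G w"
proof -
  obtain T where T: "finite T" "T \<subseteq> carrier G" "\<one> \<in> T"
    "\<And>g. g \<in> carrier G \<Longrightarrow> \<exists>h\<in>H. \<exists>t\<in>T. g = h \<otimes> t"
    using finite_transversal[OF assms(1,3)] by blast
  obtain B where B: "finite B" "B \<subseteq> H"
    "\<And>w t. w \<in> lists Y \<Longrightarrow> t \<in> T \<Longrightarrow>
      \<exists>v\<in>lists B. \<exists>t'\<in>T. length v = length w \<and> t \<otimes> word_eval G w = word_eval G v \<otimes> t'"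
    using schreier_rewriting[OF assms(1) T(2) assms(6) T(1) assms(5) T(4)] by blast
  \<comment> \<open>These representatives belong to cosets of \<open>H\<close> that meet
    \<open>P\<close>; only they can end the rewriting of a word with value in
    \<open>P\<close>.\<close>
  define T' where "T' = {t \<in> T. \<exists>h\<in>H. h \<otimes> t \<in> P}"
  obtain b where b: "\<And>t. t \<in> T' \<Longrightarrow> b t \<in> H \<and> b t \<otimes> t \<in> P"
    using bchoice[of T' "\<lambda>t h. h \<in> H \<and> h \<otimes> t \<in> P"] unfolding T'_def by blast
  define B' where "B' = B \<union> (\<lambda>t. inv (b t)) ` T'"
  have "finite T'" unfolding T'_def using T(1) by simp
  then have B': "finite B'" "B' \<subseteq> H"
    using B(1,2) b assms(1) by (auto simp: B'_def subgroup.m_inv_closed)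
  obtain X where X: "finite X" "X \<subseteq> P" "\<And>w. w \<in> lists B' \<Longrightarrow> word_eval G w \<in> P \<Longrightarrow>
      \<exists>v\<in>lists X. length v \<le> length w \<and> word_eval G v = word_eval G w"
    using abelian_subgroup_undistorted[OF assms(1) comm assms(4) B'] by blast
  define D where "D = X \<union> (\<lambda>t. b t \<otimes> t) ` T'"
  have "finite D" "D \<subseteq> P" using X \<open>finite T'\<close> b by (auto simp: D_def)
  moreover have "\<exists>v\<in>lists D. length v \<le> length w + 2 \<and> word_eval G v = word_eval G w"
    if w: "w \<in> lists Y" "word_eval G w \<in> P" for w
  proof -
    have wcar: "word_eval G w \<in> carrier G" using w(2) subgroup.mem_carrier[OF assms(4)] by blast
    obtain v t where v: "v \<in> lists B" "t \<in> T" "length v = length w"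
      "word_eval G w = word_eval G v \<otimes> t"
      using B(3)[OF w(1) T(3)] wcar by auto
    have "word_eval G v \<in> H" using v(1) B(2) assms(1) by (auto intro: word_eval_subgroup)
    then have t: "t \<in> T'" using v(2,4) w(2) by (auto simp: T'_def)
    have car: "b t \<in> carrier G" "t \<in> carrier G" "set v \<subseteq> carrier G"
      using b[OF t] v(1,2) B(2) T(2) subgroup.subset[OF assms(1)] by auto
    let ?v = "v @ [inv (b t)]"
    have eval: "word_eval G ?v = word_eval G v \<otimes> inv (b t)"
      using car by (simp add: word_eval_append)
    \<comment> \<open>Written as a quotient of two elements of \<open>P\<close>, the value of the
      corrected word is seen to lie in \<open>P\<close>.\<close>
    have quot: "word_eval G w \<otimes> inv (b t \<otimes> t) = word_eval G ?v"
      unfolding eval v(4) using car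
      by (simp add: inv_mult_group m_assoc flip: m_assoc[of t "inv t"])
    have "word_eval G ?v \<in> P"
      using b[OF t] w(2) assms(4) unfolding quot[symmetric]
      by (simp add: subgroup.m_closed subgroup.m_inv_closed)
    moreover have "?v \<in> lists B'" using v(1) t by (auto simp: B'_def)
    ultimately obtain x where x: "x \<in> lists X" "length x \<le> length ?v" "word_eval G x = word_eval G ?v"
      using X(3) by blast
    have xcar: "set x \<subseteq> carrier G" using x(1) X(2) subgroup.subset[OF assms(4)] by auto
    have "word_eval G (x @ [b t \<otimes> t]) = word_eval G ?v \<otimes> (b t \<otimes> t)"
      using xcar car by (simp add: word_eval_append x(3))
    also have "\<dots> = word_eval G w"
      unfolding quot[symmetric] using wcar car by (simp add: m_assoc)
    finally show ?thesis
      using x v(3) t by (intro bexI[of _ "x @ [b t \<otimes> t]"]) (auto simp: D_def)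
  qed
  ultimately show ?thesis using that by blast
qed

text \<open>The word is cut into \<open>m\<close> consecutive blocks of at most \<open>n\<close>
  letters, possibly empty, and each block becomes a single letter.\<close>

lemma word_eval_blocks:
  assumes "D \<subseteq> carrier G" "w \<in> lists D" "length w \<le> n * m"
  shows "\<exists>v\<in>lists (word_eval G ` {u \<in> lists D. length u \<le> n}).
    length v \<le> m \<and> word_eval G v = word_eval G w"
  using assms(2,3)
proof (induction m arbitrary: w)
  case 0
  then show ?case by (intro bexI[of _ "[]"]) auto
next
  case (Suc m)
  have D: "take n w \<in> lists D" "drop n w \<in> lists D"
    using Suc.prems(1) by (auto dest: in_set_takeD in_set_dropD)
  have "length (drop n w) \<le> n * m" using Suc.prems(2) by (simp add: le_diff_conv)
  then obtain v where v: "v \<in> lists (word_eval G ` {u \<in> lists D. length u \<le> n})"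
    "length v \<le> m" "word_eval G v = word_eval G (drop n w)"
    using Suc.IH[OF D(2)] by blast
  have "word_eval G (take n w @ drop n w) = word_eval G (take n w) \<otimes> word_eval G (drop n w)"
    using D assms(1) by (intro word_eval_append) auto
  then have "word_eval G (word_eval G (take n w) # v) = word_eval G w"
    using v(3) by simp
  moreover have "word_eval G (take n w) \<in> word_eval G ` {u \<in> lists D. length u \<le> n}"
    using D by (intro imageI) simp
  ultimately show ?case
    using v by (intro bexI[of _ "word_eval G (take n w) # v"]) auto
qed

section \<open>Geodesics of central elements\<close>

lemma subgroup_center: "subgroup (center G) G"
proof
  show "center G \<subseteq> carrier G" by (auto simp: center_def)
  show "\<one> \<in> center G" by (simp add: center_def)
next
  fix x y assume "x \<in> center G" "y \<in> center G"
  then have x: "x \<in> carrier G" "\<And>g. g \<in> carrier G \<Longrightarrow> g \<otimes> x = x \<otimes> g"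
    and y: "y \<in> carrier G" "\<And>g. g \<in> carrier G \<Longrightarrow> g \<otimes> y = y \<otimes> g"
    by (auto simp: center_def)
  have "g \<otimes> (x \<otimes> y) = x \<otimes> y \<otimes> g" if "g \<in> carrier G" for g
  proof -
    have "g \<otimes> (x \<otimes> y) = (g \<otimes> x) \<otimes> y" using x(1) y(1) that by (simp add: m_assoc)
    also have "\<dots> = x \<otimes> (g \<otimes> y)" unfolding x(2)[OF that] using x(1) y(1) that by (simp add: m_assoc)
    also have "\<dots> = x \<otimes> y \<otimes> g" unfolding y(2)[OF that] using x(1) y(1) that by (simp add: m_assoc)
    finally show ?thesis .
  qed
  then show "x \<otimes> y \<in> center G" using x(1) y(1) by (simp add: center_def)
next
  fix x assume "x \<in> center G"
  then have x: "x \<in> carrier G" "\<And>g. g \<in> carrier G \<Longrightarrow> g \<otimes> x = x \<otimes> g"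
    by (auto simp: center_def)
  have "g \<otimes> inv x = inv x \<otimes> g" if "g \<in> carrier G" for g
  proof -
    have "inv (inv g \<otimes> x) = inv (x \<otimes> inv g)" using x(2)[OF inv_closed[OF that]] by simp
    then show ?thesis using x(1) that by (simp add: inv_mult_group)
  qed
  then show "inv x \<in> center G" using x(1) by (simp add: center_def)
qed

lemma center_commute: "z \<in> center G \<Longrightarrow> g \<in> carrier G \<Longrightarrow> g \<otimes> z = z \<otimes> g"
  by (simp add: center_def)

lemma word_eval_split_central:
  assumes "set w \<subseteq> carrier G"
  shows "word_eval G w =
    word_eval G (filter (\<lambda>s. s \<notin> center G) w) \<otimes> word_eval G (filter (\<lambda>s. s \<in> center G) w)"
  using assms
proof (induction w)
  case (Cons s w)
  let ?y = "word_eval G (filter (\<lambda>s. s \<notin> center G) w)"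
  let ?x = "word_eval G (filter (\<lambda>s. s \<in> center G) w)"
  have car: "s \<in> carrier G" "?y \<in> carrier G" "?x \<in> carrier G"
    using Cons.prems by (auto intro!: word_eval_closed)
  show ?case
  proof (cases "s \<in> center G")
    case True
    have "s \<otimes> (?y \<otimes> ?x) = ?y \<otimes> s \<otimes> ?x"
      using car center_commute[OF True car(2)] by (simp add: m_assoc)
    then show ?thesis using Cons True car by (simp add: m_assoc)
  qed (use Cons car in \<open>simp add: m_assoc\<close>)
qed simp

text \<open>All letters of \<open>w\<close> are central, so the letters \<open>r\<close> deleted to
  obtain \<open>u\<close> can be collected at the end. A word for the value of \<open>u\<close>
  shorter than \<open>u\<close>, followed by \<open>r\<close>, would then be shorter than the
  geodesic \<open>w\<close> with the same value.\<close>

lemma Geo_sub_center_subseq_closed: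
  assumes "S \<subseteq> carrier G"
    and central: "\<And>w. w \<in> Geo_sub G S (center G) \<Longrightarrow> set w \<subseteq> center G"
    and w: "w \<in> Geo_sub G S (center G)" and u: "subseq u w"
  shows "u \<in> Geo_sub G S (center G)"
proof -
  have wS: "w \<in> lists S" using w by (simp add: Geo_sub_def Geo_def)
  have uw: "set u \<subseteq> set w" using set_subseq_subset[OF u] .
  have car: "set w \<subseteq> carrier G" using wS assms(1) by auto
  obtain r where r: "set r \<subseteq> set w" "length w = length u + length r"
    "word_eval G w = word_eval G u \<otimes> word_eval G r"
    using word_eval_commuting_subseq[OF u central[OF w] subgroup_center]
      center_commute subgroup.mem_carrier[OF subgroup_center] by metis
  have "length u \<le> length v" if v: "v \<in> lists S" "word_eval G v = word_eval G u" for v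
  proof -
    have "word_eval G (v @ r) = word_eval G w"
      using v r car assms(1) by (subst word_eval_append) auto
    moreover have "v @ r \<in> lists S" using v r(1) wS by auto
    ultimately have "length w \<le> length (v @ r)"
      using w unfolding Geo_sub_def Geo_def by blast
    then show ?thesis using r(2) by simp
  qed
  moreover have "u \<in> lists S" using uw wS by auto
  moreover have "word_eval G u \<in> center G"
    using uw central[OF w] by (intro word_eval_subgroup[OF subgroup_center]) blast
  ultimately show ?thesis by (simp add: Geo_sub_def Geo_def)
qed

section \<open>The relation \<open>UConj\<close> and its geodesics\<close>

lemma conj_class_nontrivial_iff:
  assumes "g \<in> carrier G"
  shows "(\<exists>x\<in>conj_class G g. \<exists>y\<in>conj_class G g. x \<noteq> y) \<longleftrightarrow> g \<notin> center G"
proof -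
  have triv: "x \<otimes> g \<otimes> inv x = g \<longleftrightarrow> x \<otimes> g = g \<otimes> x" if "x \<in> carrier G" for x
    using that assms by (metis inv_solve_right m_closed)
  \<comment> \<open>As \<open>g\<close> lies in its own class, the class has two distinct elements
    exactly when some conjugate differs from \<open>g\<close>.\<close>
  have "g \<in> conj_class G g"
    using assms by (auto simp: conj_class_def intro!: exI[of _ \<one>])
  then have "(\<exists>x\<in>conj_class G g. \<exists>y\<in>conj_class G g. x \<noteq> y) \<longleftrightarrow> (\<exists>x\<in>conj_class G g. x \<noteq> g)"
    by metis
  also have "\<dots> \<longleftrightarrow> g \<notin> center G"
    using triv assms by (auto simp: conj_class_def center_def)
  finally show ?thesis .
qed

lemma UConj_iff:
  "(g, h) \<in> UConj G \<longleftrightarrow> g \<in> carrier G \<and> h \<in> carrier G \<and>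
    (g = h \<or> g \<notin> center G \<and> h \<notin> center G)"
  using conj_class_nontrivial_iff by (auto simp: UConj_def)

text \<open>A central element is alone in its \<open>UConj\<close> class, so all its geodesics
  count. The noncentral elements form one class; any word for one of them contains a noncentral
  letter, which by itself is already a shortest word of that class.\<close>

lemma UConjGeo_eq:
  assumes "S \<subseteq> carrier G"
  shows "UConjGeo G S = Geo_sub G S (center G) \<union> {[s] | s. s \<in> S - center G}"
proof -
  have one: "\<one> \<in> center G" using subgroup.one_closed[OF subgroup_center] .
  have car: "word_eval G w \<in> carrier G" if "w \<in> Geo G S" for w
    using that assms by (intro word_eval_closed) (auto simp: Geo_def)
  have letter: "[s] \<in> Geo G S" if "s \<in> S - center G" for s
  proof -
    \<comment> \<open>Only the empty word is shorter than a letter, and its value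
      \<open>\<one>\<close> is central whereas \<open>s\<close> is not.\<close>
    have "u \<noteq> []" if "word_eval G u = word_eval G [s]" for u
      using that \<open>s \<in> S - center G\<close> assms one by auto
    then show ?thesis
      using that by (auto simp: Geo_def Suc_le_eq)
  qed
  show ?thesis
  proof (intro equalityI subsetI)
    fix w assume w: "w \<in> UConjGeo G S"
    then have geo: "w \<in> Geo G S" by (simp add: UConjGeo_def)
    show "w \<in> Geo_sub G S (center G) \<union> {[s] | s. s \<in> S - center G}"
    proof (cases "word_eval G w \<in> center G")
      case True
      then show ?thesis using geo by (simp add: Geo_sub_def)
    next
      case False
      have wS: "set w \<subseteq> S" using geo by (auto simp: Geo_def)
      obtain s where s: "s \<in> set w" "s \<notin> center G"
        using False word_eval_subgroup[OF subgroup_center] by blast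
      then have sS: "s \<in> S - center G" using wS by blast
      have "(word_eval G w, word_eval G [s]) \<in> UConj G"
        using False sS assms car[OF geo] by (auto simp: UConj_iff)
      then have "length w \<le> length [s]"
        using w letter[OF sS] by (simp only: UConjGeo_def mem_Collect_eq)
      then have "w = [s]" using s(1) by (cases w) auto
      then show ?thesis using sS by blast
    qed
  next
    fix w assume "w \<in> Geo_sub G S (center G) \<union> {[s] | s. s \<in> S - center G}"
    then consider "w \<in> Geo_sub G S (center G)" | s where "s \<in> S - center G" "w = [s]" by blast
    then show "w \<in> UConjGeo G S"
    proof cases
      case 1
      then show ?thesis
        by (auto simp: UConjGeo_def Geo_sub_def UConj_iff Geo_def)
    next
      case 2
      have "length [s] \<le> length u" if "(word_eval G [s], word_eval G u) \<in> UConj G" for u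
      proof -
        have "word_eval G u \<notin> center G" using that 2 assms by (auto simp: UConj_iff)
        then show ?thesis using one by (cases u) auto
      qed
      then show ?thesis using 2 letter by (auto simp: UConjGeo_def)
    qed
  qed
qed

section \<open>Choice of the generating set\<close>

lemma inverse_closed_generating_set_extend:
  assumes "X \<subseteq> carrier G" "generate G X = carrier G" "X \<subseteq> S" "S \<subseteq> carrier G"
  shows "inverse_closed_generating_set G (S \<union> (\<lambda>s. inv s) ` S)"
proof -
  let ?S = "S \<union> (\<lambda>s. inv s) ` S"
  have sub: "?S \<subseteq> carrier G" using assms(4) by auto
  have "carrier G \<subseteq> generate G ?S"
    using mono_generate[of X ?S] assms(2,3) by auto
  moreover have "generate G ?S \<subseteq> carrier G" using generate_incl[OF sub] .
  moreover have "inv s \<in> ?S" if "s \<in> ?S" for s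
    using that assms(4) by (auto simp: image_iff)
  ultimately show ?thesis using sub by (auto simp: inverse_closed_generating_set_def)
qed

text \<open>The noncentral letters of a central geodesic, taken in order, have a central product. If
  there are any, there are at least two, and the new central generators spell their product with
  fewer letters.\<close>

theorem generating_set_with_central_geodesics:
  assumes "finitely_generated_group G" "virtually_abelian_group G"
  obtains S where "finite S" "inverse_closed_generating_set G S"
    "\<And>w. w \<in> Geo_sub G S (center G) \<Longrightarrow> set w \<subseteq> center G"
proof -
  note Z = subgroup_center
  obtain Y0 where Y0: "finite Y0" "Y0 \<subseteq> carrier G" "generate G Y0 = carrier G"
    using assms(1) by (auto simp: finitely_generated_group_def)
  obtain H where H: "subgroup H G" "comm_group (G\<lparr>carrier := H\<rparr>)" "finite (rcosets H)"
    using assms(2) by (auto simp: virtually_abelian_group_def)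
  have comm: "x \<otimes> y = y \<otimes> x" if "x \<in> H" "y \<in> H" for x y
    using comm_monoid.m_comm[OF comm_group.axioms(1)[OF H(2)], of x y] that by simp
  define Y where "Y = Y0 \<union> (\<lambda>s. inv s) ` Y0"
  have Y: "finite Y" "Y \<subseteq> carrier G" using Y0 by (auto simp: Y_def)
  obtain D where D: "finite D" "D \<subseteq> center G" "\<And>w. w \<in> lists Y \<Longrightarrow> word_eval G w \<in> center G \<Longrightarrow>
      \<exists>v\<in>lists D. length v \<le> length w + 2 \<and> word_eval G v = word_eval G w"
    using subgroup_undistorted[OF H(1) comm H(3) Z Y] by blast
  have Dcar: "D \<subseteq> carrier G" using D(2) subgroup.subset[OF Z] by blast
  \<comment> \<open>The block length 4 is the least \<open>n\<close> with
    \<open>k + 2 \<le> n * (k - 1)\<close> for all \<open>k \<ge> 2\<close>; the case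
    \<open>k = 2\<close> forces it.\<close>
  define X where "X = word_eval G ` {u \<in> lists D. length u \<le> 4}"
  have "{u \<in> lists D. length u \<le> 4} = {u. set u \<subseteq> D \<and> length u \<le> 4}" by auto
  then have "finite X"
    unfolding X_def using finite_lists_length_le[OF D(1), of 4] by simp
  have XZ: "X \<subseteq> center G"
    unfolding X_def using D(2) by (auto intro!: word_eval_subgroup[OF Z])
  define S where "S = (Y0 \<union> X) \<union> (\<lambda>s. inv s) ` (Y0 \<union> X)"
  have "finite S" unfolding S_def using Y0(1) \<open>finite X\<close> by simp
  moreover have gen: "inverse_closed_generating_set G S"
    unfolding S_def using Y0 XZ subgroup.subset[OF Z]
    by (intro inverse_closed_generating_set_extend[of Y0]) auto
  moreover have "set w \<subseteq> center G" if w: "w \<in> Geo_sub G S (center G)" for w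
  proof (rule ccontr)
    assume noncentral: "\<not> set w \<subseteq> center G"
    have Scar: "S \<subseteq> carrier G" using gen by (simp add: inverse_closed_generating_set_def)
    have wS: "set w \<subseteq> S" and wZ: "word_eval G w \<in> center G"
      using w by (auto simp: Geo_sub_def Geo_def)
    define y where "y = filter (\<lambda>s. s \<notin> center G) w"
    define x where "x = filter (\<lambda>s. s \<in> center G) w"
    have split: "word_eval G w = word_eval G y \<otimes> word_eval G x"
      unfolding y_def x_def using wS Scar by (intro word_eval_split_central) blast
    have "inv s \<in> center G" if "s \<in> X" for s
      using that XZ subgroup.m_inv_closed[OF Z] by blast
    \<comment> \<open>The inverses of letters in \<open>X\<close> are central too, so a noncentral
      letter of \<open>S\<close> comes from \<open>Y0\<close> or its inverses, and the bound for
      words over \<open>Y\<close> applies to \<open>y\<close>.\<close>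
    then have "S - center G \<subseteq> Y" using XZ by (auto simp: S_def Y_def)
    then have yY: "y \<in> lists Y" using wS by (auto simp: y_def subset_iff)
    have ycar: "word_eval G y \<in> carrier G" using yY Y(2) by (intro word_eval_closed) auto
    have xZ: "word_eval G x \<in> center G"
      by (intro word_eval_subgroup[OF Z]) (auto simp: x_def)
    have "word_eval G y = word_eval G w \<otimes> inv (word_eval G x)"
      using split ycar subgroup.mem_carrier[OF Z xZ] by (simp add: m_assoc)
    then have yZ: "word_eval G y \<in> center G"
      using wZ xZ by (simp add: subgroup.m_closed[OF Z] subgroup.m_inv_closed[OF Z])
    have "y \<noteq> []" using noncentral by (auto simp: y_def filter_empty_conv)
    moreover have "y \<noteq> [s]" for s
    proof
      assume y: "y = [s]"
      then have "s \<in> set y" by simp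
      then have "s \<in> set w" "s \<notin> center G" by (auto simp: y_def)
      then show False using yZ y wS Scar by auto
    qed
    ultimately have len: "2 \<le> length y"
      by (cases y; cases "tl y") auto
    obtain d where d: "d \<in> lists D" "length d \<le> length y + 2" "word_eval G d = word_eval G y"
      using D(3)[OF yY yZ] by blast
    have four: "length d \<le> 4 * (length y - 1)" using d(2) len by linarith
    obtain v where v: "v \<in> lists X" "length v \<le> length y - 1" "word_eval G v = word_eval G y"
      using word_eval_blocks[OF Dcar d(1) four, folded X_def] d(3) by auto
    have "v \<in> lists S" using v(1) by (auto simp: S_def)
    moreover have "x \<in> lists S" using wS by (auto simp: x_def)
    \<comment> \<open>Replacing the noncentral part \<open>y\<close> by \<open>v\<close> keeps the
      value but saves at least one letter, contradicting that \<open>w\<close> is geodesic.\<close>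
    ultimately have "v @ x \<in> lists S" "word_eval G (v @ x) = word_eval G w"
      using Scar split v(3) by (auto simp: word_eval_append subset_iff)
    then have "length w \<le> length (v @ x)"
      using w unfolding Geo_sub_def Geo_def by blast
    moreover have "length w = length y + length x"
      using sum_length_filter_compl[of "\<lambda>s. s \<in> center G" w] by (simp add: y_def x_def)
    ultimately show False using v(2) len by simp
  qed
  ultimately show ?thesis using that by blast
qed

end

section \<open>Closure under piecewise subwords and the conclusion\<close>

theorem theorem5p6:
  fixes G :: "('a, 'b) monoid_scheme"
  assumes "group G"
    and "finitely_generated_group G"
    and "virtually_abelian_group G"
  shows "\<exists>S. finite S \<and> inverse_closed_generating_set G S \<and>
           piecewise_excluding S (Geo_sub G S (center G)) \<and>
           piecewise_excluding S (UConjGeo G S) \<and>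
           regular_language S (UConjGeo G S)"
proof -
  interpret group G by fact
  obtain S where S: "finite S" "inverse_closed_generating_set G S"
    "\<And>w. w \<in> Geo_sub G S (center G) \<Longrightarrow> set w \<subseteq> center G"
    using generating_set_with_central_geodesics assms(2,3) by blast
  have car: "S \<subseteq> carrier G" using S(2) by (simp add: inverse_closed_generating_set_def)
  note closed = Geo_sub_center_subseq_closed[OF car S(3)]
  \<comment> \<open>The single noncentral letters in \<open>UConjGeo G S\<close> have the empty word
    as their only proper piecewise subword.\<close>
  have "[] \<in> Geo_sub G S (center G)"
    using subgroup.one_closed[OF subgroup_center] by (simp add: Geo_sub_def Geo_def)
  then have closed': "u \<in> UConjGeo G S" if "w \<in> UConjGeo G S" "subseq u w" for u w
    using that closed unfolding UConjGeo_eq[OF car]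
    by (cases u) (auto simp: subseq_Cons2_iff subseq_singleton_left split: if_splits)
  have "piecewise_excluding S (Geo_sub G S (center G))"
    by (rule subseq_closed_imp_piecewise_excluding[OF S(1) _ closed])
      (auto simp: Geo_sub_def Geo_def)
  moreover have "piecewise_excluding S (UConjGeo G S)"
    by (rule subseq_closed_imp_piecewise_excluding[OF S(1) _ closed'])
      (auto simp: UConjGeo_def Geo_def)
  ultimately show ?thesis
    using S(1,2) piecewise_excluding_imp_regular by blast
qed

end
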